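(* Let $\rho\colon L^\infty_c\to\mathbb{R}$ be a coherent risk measure. Suppose that $\rho(\mathbf{1}_{A_n})\downarrow0$ whenever the sequence of events $(A_n)_{n\in\mathbb{N}}\subseteq\mathcal{F}$ satisfies $A_n\downarrow\emptyset$. Then $\rho^Q_E=\rho^Q_D$ for all $Q\in\mathfrak{P}_c(\Omega)$.
   Context: $(\Omega,\mathcal{F})$ is a measurable space and $\mathcal{P}$ is a non-empty set of probability measures on it; $c(A):=\sup_{P\in\mathcal{P}}P(A)$ for $A\in\mathcal{F}$. An event $A\in\mathcal{F}$ is $\mathcal{P}$-polar if $c(A)=0$; a property holds $\mathcal{P}$-q.s. if it holds outside a $\mathcal{P}$-polar event. $\mathfrak{P}_c(\Omega)$ is the set of probability measures on $(\Omega,\mathcal{F})$ vanishing on all $\mathcal{P}$-polar events. $L^0_c$ is the space of equivalence classes $[x]_c$ of real-valued random variables up to $\mathcal{P}$-q.s. equality, with order $X\preccurlyeq Y$ iff $x\le y$ $\mathcal{P}$-q.s. for representatives; $\mathbf{1}_A$ is the class of the indicator of $A$; constants are identified with the classes they induce; $L^\infty_c:=\{X\in L^0_c\mid\exists m>0\colon|X|\preccurlyeq m\}$. For $Q\in\mathfrak{P}_c(\Omega)$, $j_Q([x]_c):=[x]_Q$, where $[x]_Q$ is the class of $x$ modulo $Q$-a.s. equality, and $ca_Q$ is the space of finite signed (countably additive) measures $\mu$ with $|\mu|\ll Q$. A coherent risk measure is a map $\rho\colon L^\infty_c\to\mathbb{R}$ that is monotone ($X_1\preccurlyeq X_2\Rightarrow\rho(X_1)\le\rho(X_2)$),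 cash-additive ($\rho(X+m)=\rho(X)+m$ for $m\in\mathbb{R}$), convex, and positively homogeneous ($\rho(\lambda X)=\lambda\rho(X)$ for $\lambda\ge0$). For $Q\in\mathfrak{P}_c(\Omega)$ and $X\in L^\infty_c$: $\rho^Q_E(X):=\inf\{r\in\mathbb{R}\mid j_Q(X)\in j_Q(\{Y\in L^\infty_c\mid\rho(Y)\le r\})\}\in[-\infty,\infty]$, $\overline{\rho}^Q(\mu):=\sup_{X\in L^\infty_c}\big(\int X\,d\mu-\rho^Q_E(X)\big)$ for $\mu\in ca_Q$, and $\rho^Q_D(X):=\sup_{\mu\in ca_Q}\big(\int X\,d\mu-\overline{\rho}^Q(\mu)\big)$. *)

theory Defs
  imports "HOL-Probability.Probability"
begin

(* The measure M only carries the measurable space (space M, sets M); its values are never used.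
   Random variables are total functions 'a => real, so their values off space M are irrelevant:
   all the equivalences below only look at points of space M. *)

definition upper_prob :: "'a measure set \<Rightarrow> 'a set \<Rightarrow> ennreal" where
  "upper_prob \<P> A = (SUP P\<in>\<P>. emeasure P A)"

definition polar_sets :: "'a measure \<Rightarrow> 'a measure set \<Rightarrow> 'a set set" where
  "polar_sets M \<P> = {A \<in> sets M. upper_prob \<P> A = 0}"

definition quasi_surely :: "'a measure \<Rightarrow> 'a measure set \<Rightarrow> ('a \<Rightarrow> bool) \<Rightarrow> bool" where
  "quasi_surely M \<P> \<phi> \<longleftrightarrow> (\<exists>N\<in>polar_sets M \<P>. \<forall>\<omega>\<in>space M - N. \<phi> \<omega>)"

definition prob_c :: "'a measure \<Rightarrow> 'a measure set \<Rightarrow> 'a measure set" where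
  "prob_c M \<P> = {Q \<in> space (prob_algebra M). \<forall>A\<in>polar_sets M \<P>. emeasure Q A = 0}"

definition qs_rel :: "'a measure \<Rightarrow> 'a measure set \<Rightarrow> ('a \<Rightarrow> real) rel" where
  "qs_rel M \<P> = {(x, y). x \<in> borel_measurable M \<and> y \<in> borel_measurable M \<and>
                         quasi_surely M \<P> (\<lambda>\<omega>. x \<omega> = y \<omega>)}"

definition qs_class :: "'a measure \<Rightarrow> 'a measure set \<Rightarrow> ('a \<Rightarrow> real) \<Rightarrow> ('a \<Rightarrow> real) set" where
  "qs_class M \<P> x = qs_rel M \<P> `` {x}"

definition L0_c :: "'a measure \<Rightarrow> 'a measure set \<Rightarrow> ('a \<Rightarrow> real) set set" where
  "L0_c M \<P> = borel_measurable M // qs_rel M \<P>"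

definition le_c ::
  "'a measure \<Rightarrow> 'a measure set \<Rightarrow> ('a \<Rightarrow> real) set \<Rightarrow> ('a \<Rightarrow> real) set \<Rightarrow> bool" where
  "le_c M \<P> X Y \<longleftrightarrow> (\<exists>x\<in>X. \<exists>y\<in>Y. quasi_surely M \<P> (\<lambda>\<omega>. x \<omega> \<le> y \<omega>))"

definition Linf_c :: "'a measure \<Rightarrow> 'a measure set \<Rightarrow> ('a \<Rightarrow> real) set set" where
  "Linf_c M \<P> = {X \<in> L0_c M \<P>. \<exists>m>0. \<exists>x\<in>X.
     le_c M \<P> (qs_class M \<P> (\<lambda>\<omega>. \<bar>x \<omega>\<bar>)) (qs_class M \<P> (\<lambda>_. m))}"

definition as_rel :: "'a measure \<Rightarrow> ('a \<Rightarrow> real) rel" where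
  "as_rel Q = {(x, y). x \<in> borel_measurable Q \<and> y \<in> borel_measurable Q \<and> (AE \<omega> in Q. x \<omega> = y \<omega>)}"

definition as_class :: "'a measure \<Rightarrow> ('a \<Rightarrow> real) \<Rightarrow> ('a \<Rightarrow> real) set" where
  "as_class Q x = as_rel Q `` {x}"

(* j_Q is the union of the Q-classes of all representatives; these Q-classes coincide
   for Q in prob_c M \<P>, see lemma j_map_qs_class. *)
definition j_map :: "'a measure \<Rightarrow> ('a \<Rightarrow> real) set \<Rightarrow> ('a \<Rightarrow> real) set" where
  "j_map Q X = (\<Union>x\<in>X. as_class Q x)"

(* The vector space operations on classes are those of representatives, and
   a map on Linf_c is a total function whose values off Linf_c are irrelevant. *)
definition coherent_risk_measure ::
  "'a measure \<Rightarrow> 'a measure set \<Rightarrow> (('a \<Rightarrow> real) set \<Rightarrow> real) \<Rightarrow> bool" where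
  "coherent_risk_measure M \<P> \<rho> \<longleftrightarrow>
     (\<forall>X\<in>Linf_c M \<P>. \<forall>Y\<in>Linf_c M \<P>. le_c M \<P> X Y \<longrightarrow> \<rho> X \<le> \<rho> Y) \<and>
     (\<forall>X\<in>Linf_c M \<P>. \<forall>x\<in>X. \<forall>m::real. \<rho> (qs_class M \<P> (\<lambda>\<omega>. x \<omega> + m)) = \<rho> X + m) \<and>
     (\<forall>X\<in>Linf_c M \<P>. \<forall>Y\<in>Linf_c M \<P>. \<forall>x\<in>X. \<forall>y\<in>Y. \<forall>t\<in>{0..1}.
        \<rho> (qs_class M \<P> (\<lambda>\<omega>. t * x \<omega> + (1 - t) * y \<omega>)) \<le> t * \<rho> X + (1 - t) * \<rho> Y) \<and>
     (\<forall>X\<in>Linf_c M \<P>. \<forall>x\<in>X. \<forall>t\<ge>0. \<rho> (qs_class M \<P> (\<lambda>\<omega>. t * x \<omega>)) = t * \<rho> X)"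

definition signed_measure :: "'a measure \<Rightarrow> ('a set \<Rightarrow> real) \<Rightarrow> bool" where
  "signed_measure M \<mu> \<longleftrightarrow> \<mu> {} = 0 \<and>
     (\<forall>A :: nat \<Rightarrow> 'a set. range A \<subseteq> sets M \<longrightarrow> disjoint_family A \<longrightarrow>
        (\<lambda>n. \<mu> (A n)) sums \<mu> (\<Union>n. A n))"

(* The value of the positive part of the Jordan decomposition of \<mu> at A, i.e. the supremum of
   \<mu> B over measurable B contained in A. Truncation of negative values by ennreal is harmless since
   \<mu> {} = 0 is among the values. *)
definition upper_var :: "'a measure \<Rightarrow> ('a set \<Rightarrow> real) \<Rightarrow> 'a set \<Rightarrow> ennreal" where
  "upper_var M \<mu> A = (SUP B\<in>{B \<in> sets M. B \<subseteq> A}. ennreal (\<mu> B))"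

definition pos_measure :: "'a measure \<Rightarrow> ('a set \<Rightarrow> real) \<Rightarrow> 'a measure" where
  "pos_measure M \<mu> = measure_of (space M) (sets M) (upper_var M \<mu>)"

definition neg_measure :: "'a measure \<Rightarrow> ('a set \<Rightarrow> real) \<Rightarrow> 'a measure" where
  "neg_measure M \<mu> = pos_measure M (\<lambda>A. - \<mu> A)"

definition abs_measure :: "'a measure \<Rightarrow> ('a set \<Rightarrow> real) \<Rightarrow> 'a measure" where
  "abs_measure M \<mu> = measure_of (space M) (sets M)
     (\<lambda>A. emeasure (pos_measure M \<mu>) A + emeasure (neg_measure M \<mu>) A)"

(* The values of \<mu> off sets M are unconstrained and irrelevant. *)
definition ca :: "'a measure \<Rightarrow> 'a measure \<Rightarrow> ('a set \<Rightarrow> real) set" where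
  "ca M Q = {\<mu>. signed_measure M \<mu> \<and> absolutely_continuous Q (abs_measure M \<mu>)}"

(* For \<mu> in ca M Q and Q in prob_c M \<P> the integral of a class in Linf_c does not depend on the
   representative. *)
definition class_integral :: "'a measure \<Rightarrow> ('a set \<Rightarrow> real) \<Rightarrow> ('a \<Rightarrow> real) set \<Rightarrow> real" where
  "class_integral M \<mu> X =
     (let x = (SOME x. x \<in> X)
      in integral\<^sup>L (pos_measure M \<mu>) x - integral\<^sup>L (neg_measure M \<mu>) x)"

definition rho_E :: "'a measure \<Rightarrow> 'a measure set \<Rightarrow> (('a \<Rightarrow> real) set \<Rightarrow> real) \<Rightarrow> 'a measure
    \<Rightarrow> ('a \<Rightarrow> real) set \<Rightarrow> ereal" where
  "rho_E M \<P> \<rho> Q X = Inf {ereal r | r. j_map Q X \<in> j_map Q ` {Y \<in> Linf_c M \<P>. \<rho> Y \<le> r}}"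

definition rho_conj :: "'a measure \<Rightarrow> 'a measure set \<Rightarrow> (('a \<Rightarrow> real) set \<Rightarrow> real) \<Rightarrow> 'a measure
    \<Rightarrow> ('a set \<Rightarrow> real) \<Rightarrow> ereal" where
  "rho_conj M \<P> \<rho> Q \<mu> = (SUP X\<in>Linf_c M \<P>. ereal (class_integral M \<mu> X) - rho_E M \<P> \<rho> Q X)"

definition rho_D :: "'a measure \<Rightarrow> 'a measure set \<Rightarrow> (('a \<Rightarrow> real) set \<Rightarrow> real) \<Rightarrow> 'a measure
    \<Rightarrow> ('a \<Rightarrow> real) set \<Rightarrow> ereal" where
  "rho_D M \<P> \<rho> Q X = (SUP \<mu>\<in>ca M Q. ereal (class_integral M \<mu> X) - rho_conj M \<P> \<rho> Q \<mu>)"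

lemma quasi_surely_conj:
  assumes "\<P> \<subseteq> space (prob_algebra M)" "quasi_surely M \<P> \<phi>" "quasi_surely M \<P> \<psi>"
  shows "quasi_surely M \<P> (\<lambda>\<omega>. \<phi> \<omega> \<and> \<psi> \<omega>)"
proof -
  obtain A B where A: "A \<in> polar_sets M \<P>" "\<forall>\<omega>\<in>space M - A. \<phi> \<omega>"
    and B: "B \<in> polar_sets M \<P>" "\<forall>\<omega>\<in>space M - B. \<psi> \<omega>"
    using assms(2,3) unfolding quasi_surely_def by blast
  have "emeasure P (A \<union> B) = 0" if "P \<in> \<P>" for P
  proof -
    have "sets P = sets M" using that assms(1) by (auto simp: space_prob_algebra)
    moreover have "emeasure P A = 0" "emeasure P B = 0"
      using A(1) B(1) that by (auto simp: polar_sets_def upper_prob_def SUP_eq_iff bot_ennreal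
          simp flip: bot_ennreal)
    ultimately show ?thesis
      using A(1) B(1) by (intro emeasure_Un_null_set[THEN trans]) (auto simp: polar_sets_def)
  qed
  then have "A \<union> B \<in> polar_sets M \<P>"
    using A(1) B(1) by (auto simp: polar_sets_def upper_prob_def simp flip: bot_ennreal)
  then show ?thesis unfolding quasi_surely_def using A(2) B(2) by blast
qed

lemma quasi_surely_mono:
  "quasi_surely M \<P> \<phi> \<Longrightarrow> (\<And>\<omega>. \<phi> \<omega> \<Longrightarrow> \<psi> \<omega>) \<Longrightarrow> quasi_surely M \<P> \<psi>"
  unfolding quasi_surely_def by blast

lemma equiv_qs_rel:
  assumes "\<P> \<subseteq> space (prob_algebra M)"
  shows "equiv (borel_measurable M) (qs_rel M \<P>)"
proof (rule equivI)
  have "{} \<in> polar_sets M \<P>" by (auto simp: polar_sets_def upper_prob_def simp flip: bot_ennreal)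
  then show "refl_on (borel_measurable M) (qs_rel M \<P>)"
    by (auto simp: refl_on_def qs_rel_def quasi_surely_def)
  show "qs_rel M \<P> \<subseteq> borel_measurable M \<times> borel_measurable M" by (auto simp: qs_rel_def)
  show "sym (qs_rel M \<P>)" by (auto simp: sym_def qs_rel_def eq_commute)
  show "trans (qs_rel M \<P>)"
  proof (rule transI)
    fix x y z assume "(x, y) \<in> qs_rel M \<P>" "(y, z) \<in> qs_rel M \<P>"
    then show "(x, z) \<in> qs_rel M \<P>"
      using quasi_surely_conj[OF assms, of "\<lambda>\<omega>. x \<omega> = y \<omega>" "\<lambda>\<omega>. y \<omega> = z \<omega>"]
      unfolding qs_rel_def by (auto elim: quasi_surely_mono)
  qed
qed

lemma j_map_qs_class:
  assumes "\<P> \<subseteq> space (prob_algebra M)" "Q \<in> prob_c M \<P>" "x \<in> borel_measurable M"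
  shows "j_map Q (qs_class M \<P> x) = as_class Q x"
proof -
  have s: "sets Q = sets M" using assms(2) by (auto simp: prob_c_def space_prob_algebra)
  have m: "borel_measurable Q = (borel_measurable M :: ('a \<Rightarrow> real) set)"
    using s by (intro measurable_cong_sets) auto
  have ae: "AE \<omega> in Q. x \<omega> = y \<omega>" if xy: "(x, y) \<in> qs_rel M \<P>" for y
  proof -
    obtain N where N: "N \<in> polar_sets M \<P>" "\<forall>\<omega>\<in>space M - N. x \<omega> = y \<omega>"
      using xy by (auto simp: qs_rel_def quasi_surely_def)
    then have "N \<in> null_sets Q" using assms(2) s by (auto simp: prob_c_def polar_sets_def null_sets_def)
    then show ?thesis using N(2) sets_eq_imp_space_eq[OF s] by (intro AE_I') auto
  qed
  have "(x, x) \<in> qs_rel M \<P>"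
    using equiv_qs_rel[OF assms(1)] assms(3) by (auto simp: equiv_def refl_on_def)
  moreover have "as_class Q y = as_class Q x" if "(x, y) \<in> qs_rel M \<P>" for y
  proof -
    have xy: "AE \<omega> in Q. x \<omega> = y \<omega>" by (rule ae[OF that])
    have "(AE \<omega> in Q. y \<omega> = z \<omega>) \<longleftrightarrow> (AE \<omega> in Q. x \<omega> = z \<omega>)" for z
      by (rule eventually_subst, rule eventually_mono[OF xy]) simp
    moreover have "y \<in> borel_measurable M" using that by (simp add: qs_rel_def)
    ultimately show ?thesis using assms(3) by (simp add: as_class_def as_rel_def m Image_def)
  qed
  ultimately show ?thesis unfolding j_map_def qs_class_def by blast
qed

end

theory Submission
  imports Defs "HOL-Library.Function_Algebras"
begin

text \<open>
  On bounded measurable functions the risk measure is a monotone sublinear functional \<open>r\<close>, and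
  \<open>\<rho>\<^sub>E(x)\<close> is the infimum of \<open>r(x + k)\<close> over the subspace \<open>K\<close> of those \<open>k\<close> that vanish \<open>Q\<close>-almost
  surely (\<open>rho_E_eq_INF\<close>). The inequality \<open>\<rho>\<^sub>D \<le> \<rho>\<^sub>E\<close> is the Fenchel inequality.
  For the converse there are two cases.

  If \<open>r(k) < 0\<close> for some \<open>k \<in> K\<close>, adding large multiples of \<open>k\<close> shows that \<open>\<rho>\<^sub>E\<close> is identically
  \<open>-\<infinity>\<close>, and there is nothing to prove. Otherwise \<open>\<rho>\<^sub>E\<close> is a finite sublinear functional on
  bounded measurable functions (\<open>sublinear_quotient\<close>), and by the Hahn-Banach theorem
  (\<open>Hahn_Banach_attained\<close>) some linear functional \<open>l \<le> \<rho>\<^sub>E\<close> agrees with \<open>\<rho>\<^sub>E\<close> at the given \<open>x\<close>. As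
  \<open>l \<le> r\<close>, monotonicity makes \<open>l\<close> positive, and the assumption on \<open>\<rho>(1\<^sub>A)\<close> along sequences of events
  that decrease to the empty set makes \<open>l(1\<^sub>A)\<close> tend to zero along them. Hence \<open>l\<close> is integration
  against a finite measure \<open>N\<close> (\<open>Daniell_bounded_measurable\<close>). As \<open>l\<close> vanishes on \<open>K\<close>, this measure
  is absolutely continuous with respect to \<open>Q\<close>. The bound \<open>l \<le> \<rho>\<^sub>E\<close> says that the conjugate of \<open>\<rho>\<^sub>E\<close>
  at \<open>N\<close> is at most zero, so \<open>N\<close> contributes at least \<open>l(x) = \<rho>\<^sub>E(x)\<close> to the supremum that defines
  \<open>\<rho>\<^sub>D(x)\<close>.
\<close>

section \<open>Sublinear functionals and the Hahn-Banach theorem\<close>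

text \<open>
  With pointwise operations, the bounded measurable functions are a subspace of a real vector
  space, so the abstract theory of sublinear functionals applies to them.
\<close>

instantiation "fun" :: (type, real_vector) real_vector
begin

definition scaleR_fun :: "real \<Rightarrow> ('a \<Rightarrow> 'b) \<Rightarrow> 'a \<Rightarrow> 'b"
  where "scaleR_fun t f = (\<lambda>x. t *\<^sub>R f x)"

instance
  by standard (simp_all add: scaleR_fun_def fun_eq_iff algebra_simps)

end

lemma scaleR_fun_apply [simp]: "(t *\<^sub>R f) x = t *\<^sub>R f x"
  by (simp add: scaleR_fun_def)

definition sublinear :: "('v::real_vector \<Rightarrow> real) \<Rightarrow> bool" where
  "sublinear p \<longleftrightarrow> (\<forall>x y. p (x + y) \<le> p x + p y) \<and> (\<forall>x. \<forall>t\<ge>0. p (t *\<^sub>R x) = t * p x)"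

lemma sublinearD:
  assumes "sublinear p"
  shows sublinear_add: "p (x + y) \<le> p x + p y"
    and sublinear_scale: "t \<ge> 0 \<Longrightarrow> p (t *\<^sub>R x) = t * p x"
    and sublinear_zero: "p 0 = 0"
    and sublinear_minus: "- p (- x) \<le> p x"
proof -
  show *: "p (x + y) \<le> p x + p y" for x y
    using assms by (auto simp: sublinear_def)
  show s: "t \<ge> 0 \<Longrightarrow> p (t *\<^sub>R x) = t * p x" for t x
    using assms by (auto simp: sublinear_def)
  show z: "p 0 = 0" using s[of 0 0] by simp
  show "- p (- x) \<le> p x" using *[of x "- x"] z by simp
qed

text \<open>
  The inequality in \<open>scale\<close> suffices because the reverse one follows by applying it with \<open>1 / t\<close>.
\<close>

lemma sublinearI:
  assumes add: "\<And>x y. p (x + y) \<le> p x + p y"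
    and zero: "p 0 = 0"
    and scale: "\<And>t x. t > 0 \<Longrightarrow> p (t *\<^sub>R x) \<le> t * p x"
  shows "sublinear p"
  unfolding sublinear_def
proof (intro conjI allI impI)
  fix t :: real and x assume "t \<ge> 0"
  show "p (t *\<^sub>R x) = t * p x"
  proof (cases "t = 0")
    case False
    then have t: "t > 0" using \<open>t \<ge> 0\<close> by simp
    have "p ((1 / t) *\<^sub>R (t *\<^sub>R x)) \<le> (1 / t) * p (t *\<^sub>R x)" using t by (intro scale) simp
    then have "t * p x \<le> p (t *\<^sub>R x)" using t by (simp add: field_simps)
    then show ?thesis using scale[OF t, of x] by simp
  qed (simp add: zero)
qed (rule add)

text \<open>
  Composing with a linear projection onto the subspace extends a sublinear functional to the
  whole space. All later arguments can therefore work without a carrier set.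
\<close>

lemma sublinear_extension:
  assumes S: "subspace S"
    and add: "\<And>x y. x \<in> S \<Longrightarrow> y \<in> S \<Longrightarrow> r (x + y) \<le> r x + r y"
    and scale: "\<And>t x. t \<ge> 0 \<Longrightarrow> x \<in> S \<Longrightarrow> r (t *\<^sub>R x) = t * r x"
  obtains p where "sublinear p" "\<And>x. x \<in> S \<Longrightarrow> p x = r x"
proof -
  obtain g where g: "range g \<subseteq> S" "linear g" "\<And>v. v \<in> S \<Longrightarrow> g v = v"
    using linear_exists_left_inverse_on[OF linear_id S] by auto
  have "sublinear (\<lambda>x. r (g x))"
    using g(1) by (auto simp: sublinear_def linear_add[OF g(2)] linear_scale[OF g(2)] add scale image_subset_iff)
  then show thesis using g(3) by (intro that[of "\<lambda>x. r (g x)"]) auto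
qed

text \<open>
  This is the functional that \<open>p\<close> induces on the quotient by \<open>K\<close>. It is finite because
  \<open>0 \<le> p(k) \<le> p(x + k) + p(-x)\<close>.
\<close>

lemma sublinear_quotient:
  assumes p: "sublinear p" and K: "subspace K" and nonneg: "\<And>k. k \<in> K \<Longrightarrow> p k \<ge> 0"
  shows "bdd_below ((\<lambda>k. p (x + k)) ` K)"
    and "sublinear (\<lambda>x. INF k\<in>K. p (x + k))"
proof -
  let ?q = "\<lambda>x. INF k\<in>K. p (x + k)"
  have ne: "K \<noteq> {}" using subspace_0[OF K] by auto
  show bdd: "bdd_below ((\<lambda>k. p (x + k)) ` K)" for x
  proof (rule bdd_belowI2)
    fix k assume "k \<in> K"
    then show "- p (- x) \<le> p (x + k)"
      using sublinear_add[OF p, of "x + k" "- x"] nonneg[of k] by (simp add: algebra_simps)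
  qed
  show "sublinear ?q"
  proof (rule sublinearI)
    have "?q 0 \<le> p (0 + 0)" using subspace_0[OF K] by (intro cINF_lower[OF bdd])
    moreover have "0 \<le> ?q 0" using nonneg by (intro cINF_greatest[OF ne]) simp
    ultimately show "?q 0 = 0" using sublinear_zero[OF p] by simp
  next
    fix x y
    have "?q (x + y) - p (x + k) \<le> ?q y" if k: "k \<in> K" for k
    proof (rule cINF_greatest[OF ne])
      fix l assume "l \<in> K"
      then have "?q (x + y) \<le> p (x + y + (k + l))"
        using k K by (intro cINF_lower[OF bdd]) (auto intro: subspace_add)
      also have "\<dots> \<le> p (x + k) + p (y + l)"
        using sublinear_add[OF p, of "x + k" "y + l"] by (simp add: algebra_simps)
      finally show "?q (x + y) - p (x + k) \<le> p (y + l)" by simp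
    qed
    then have "?q (x + y) - ?q y \<le> ?q x"
      by (intro cINF_greatest[OF ne]) (simp add: algebra_simps)
    then show "?q (x + y) \<le> ?q x + ?q y" by simp
  next
    fix t :: real and x assume t: "t > 0"
    have "?q (t *\<^sub>R x) / t \<le> ?q x"
    proof (rule cINF_greatest[OF ne])
      fix k assume "k \<in> K"
      then have "?q (t *\<^sub>R x) \<le> p (t *\<^sub>R x + t *\<^sub>R k)"
        using K by (intro cINF_lower[OF bdd]) (auto intro: subspace_scale)
      also have "\<dots> = t * p (x + k)"
        using sublinear_scale[OF p, of t "x + k"] t by (simp add: scaleR_add_right)
      finally show "?q (t *\<^sub>R x) / t \<le> p (x + k)" using t by (simp add: field_simps)
    qed
    then show "?q (t *\<^sub>R x) \<le> t * ?q x" using t by (simp add: field_simps)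
  qed
qed

text \<open>
  The functional \<open>q'\<close> is the largest sublinear functional below \<open>q\<close> whose value at \<open>-y\<close> is at most
  \<open>- q(y)\<close>. It serves twice: if \<open>q\<close> is minimal then \<open>q' = q\<close>, which forces \<open>q\<close> to be odd; and any
  linear functional below \<open>q'\<close> has value at least \<open>q(y)\<close> at \<open>y\<close>.
\<close>

lemma sublinear_lowered_along:
  fixes q :: "'v::real_vector \<Rightarrow> real" and y :: 'v
  assumes q: "sublinear q"
  defines "q' \<equiv> \<lambda>x. INF t\<in>{0..}. q (x + t *\<^sub>R y) - t * q y"
  shows "sublinear q'" and "q' x \<le> q x" and "q' (- y) \<le> - q y"
proof -
  have bdd: "bdd_below ((\<lambda>t. q (x + t *\<^sub>R y) - t * q y) ` {0..})" for x
  proof (rule bdd_belowI2)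
    fix t :: real assume "t \<in> {0..}"
    then show "- q (- x) \<le> q (x + t *\<^sub>R y) - t * q y"
      using sublinear_add[OF q, of "x + t *\<^sub>R y" "- x"] sublinear_scale[OF q, of t y]
      by (simp add: algebra_simps)
  qed
  have lower: "q' x \<le> q (x + t *\<^sub>R y) - t * q y" if "t \<ge> 0" for x t
    unfolding q'_def using that by (intro cINF_lower[OF bdd]) auto
  have greatest: "c \<le> q' x" if "\<And>t. t \<ge> 0 \<Longrightarrow> c \<le> q (x + t *\<^sub>R y) - t * q y" for c x
    unfolding q'_def using that by (intro cINF_greatest) auto
  show le: "q' x \<le> q x" for x using lower[of 0 x] by simp
  show "q' (- y) \<le> - q y" using lower[of 1 "- y"] sublinear_zero[OF q] by simp
  show "sublinear q'"
  proof (rule sublinearI)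
    have "0 \<le> q' 0"
      by (rule greatest) (simp add: sublinear_scale[OF q])
    then show "q' 0 = 0" using le[of 0] sublinear_zero[OF q] by simp
  next
    fix u v
    have "q' (u + v) - (q (u + t *\<^sub>R y) - t * q y) \<le> q' v" if t: "t \<ge> 0" for t
    proof (rule greatest)
      fix s :: real assume s: "s \<ge> 0"
      have "q' (u + v) \<le> q (u + v + (t + s) *\<^sub>R y) - (t + s) * q y"
        using t s by (intro lower) simp
      also have "\<dots> \<le> q (u + t *\<^sub>R y) + q (v + s *\<^sub>R y) - (t + s) * q y"
        using sublinear_add[OF q, of "u + t *\<^sub>R y" "v + s *\<^sub>R y"] by (simp add: algebra_simps)
      finally show "q' (u + v) - (q (u + t *\<^sub>R y) - t * q y) \<le> q (v + s *\<^sub>R y) - s * q y"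
        by (simp add: algebra_simps)
    qed
    then have "q' (u + v) - q' v \<le> q' u" by (intro greatest) (simp add: algebra_simps)
    then show "q' (u + v) \<le> q' u + q' v" by simp
  next
    fix s :: real and u assume s: "s > 0"
    have "q' (s *\<^sub>R u) / s \<le> q' u"
    proof (rule greatest)
      fix t :: real assume t: "t \<ge> 0"
      have "q' (s *\<^sub>R u) \<le> q (s *\<^sub>R u + (s * t) *\<^sub>R y) - (s * t) * q y"
        using s t by (intro lower) simp
      also have "\<dots> = s * (q (u + t *\<^sub>R y) - t * q y)"
        using sublinear_scale[OF q, of s "u + t *\<^sub>R y"] s by (simp add: algebra_simps)
      finally show "q' (s *\<^sub>R u) / s \<le> q (u + t *\<^sub>R y) - t * q y" using s by (simp add: field_simps)
    qed
    then show "q' (s *\<^sub>R u) \<le> s * q' u" using s by (simp add: field_simps)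
  qed
qed

lemma minimal_sublinear_imp_linear:
  assumes q: "sublinear q" and min: "\<And>q'. sublinear q' \<Longrightarrow> q' \<le> q \<Longrightarrow> q' = q"
  shows "linear q"
proof -
  have odd: "q (- y) = - q y" for y
  proof -
    let ?q' = "\<lambda>x. INF t\<in>{0..}. q (x + t *\<^sub>R y) - t * q y"
    have eq: "?q' = q"
      using sublinear_lowered_along(1,2)[OF q, where y = y] by (intro min) (auto simp: le_fun_def)
    have "q (- y) \<le> - q y"
      using fun_cong[OF eq, of "- y"] sublinear_lowered_along(3)[OF q, where y = y] by linarith
    then show ?thesis using sublinear_minus[OF q, of y] by simp
  qed
  show ?thesis
  proof (rule linearI)
    fix x y
    have "q (x + y) \<ge> q x + q y"
      using sublinear_add[OF q, of "- x" "- y"] odd[of "x + y"] odd[of x] odd[of y] by simp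
    then show "q (x + y) = q x + q y" using sublinear_add[OF q, of x y] by simp
  next
    fix t x
    show "q (t *\<^sub>R x) = t *\<^sub>R q x"
    proof (cases "t \<ge> 0")
      case False
      then have "q ((- t) *\<^sub>R x) = (- t) * q x" by (intro sublinear_scale[OF q]) simp
      then show ?thesis using odd[of "t *\<^sub>R x"] by simp
    qed (simp add: sublinear_scale[OF q])
  qed
qed

text \<open>
  Lower bounds of chains, as required by Zorn's lemma. The infimum is finite because every member
  \<open>q\<close> of the chain satisfies \<open>q(x) \<ge> - q(-x) \<ge> - p(-x)\<close>. It is subadditive because any two members
  have a common lower bound in the chain.
\<close>

lemma sublinear_INF_chain:
  assumes ne: "C \<noteq> {}" and sub: "\<And>q. q \<in> C \<Longrightarrow> sublinear q \<and> q \<le> p"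
    and chain: "\<And>q q'. q \<in> C \<Longrightarrow> q' \<in> C \<Longrightarrow> q \<le> q' \<or> q' \<le> q"
  shows "sublinear (\<lambda>x. INF q\<in>C. q x)" and "q \<in> C \<Longrightarrow> (INF q\<in>C. q x) \<le> q x"
proof -
  let ?u = "\<lambda>x. INF q\<in>C. q x"
  have bdd: "bdd_below ((\<lambda>q. q x) ` C)" for x
  proof (rule bdd_belowI2)
    fix q assume "q \<in> C"
    then show "- p (- x) \<le> q x"
      using sublinear_minus[of q x] sub[of q] le_funD[of q p "- x"] by fastforce
  qed
  show lower: "?u x \<le> q x" if "q \<in> C" for q x using that by (intro cINF_lower[OF bdd])
  show "sublinear ?u"
  proof (rule sublinearI)
    have "(\<lambda>q. q 0) ` C = {0}" using ne sub by (auto simp: sublinear_zero image_iff)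
    then show "?u 0 = 0" by simp
  next
    fix x y
    have "?u (x + y) - q x \<le> ?u y" if q: "q \<in> C" for q
    proof (rule cINF_greatest[OF ne])
      fix q' assume q': "q' \<in> C"
      obtain m where m: "m \<in> C" "m \<le> q" "m \<le> q'" using chain[OF q q'] q q' by blast
      have "?u (x + y) \<le> m (x + y)" by (rule lower[OF m(1)])
      also have "\<dots> \<le> m x + m y" using sub[OF m(1)] by (auto intro: sublinear_add)
      also have "\<dots> \<le> q x + q' y" using le_funD[OF m(2), of x] le_funD[OF m(3), of y] by simp
      finally show "?u (x + y) - q x \<le> q' y" by simp
    qed
    then have "?u (x + y) - ?u y \<le> ?u x"
      by (intro cINF_greatest[OF ne]) (simp add: algebra_simps)
    then show "?u (x + y) \<le> ?u x + ?u y" by simp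
  next
    fix t :: real and x assume t: "t > 0"
    have "?u (t *\<^sub>R x) / t \<le> ?u x"
    proof (rule cINF_greatest[OF ne])
      fix q assume q: "q \<in> C"
      then have "q (t *\<^sub>R x) = t * q x" using t sub by (intro sublinear_scale) auto
      then show "?u (t *\<^sub>R x) / t \<le> q x" using lower[OF q, of "t *\<^sub>R x"] t by (simp add: field_simps)
    qed
    then show "?u (t *\<^sub>R x) \<le> t * ?u x" using t by (simp add: field_simps)
  qed
qed

text \<open>
  Zorn's lemma yields a minimal sublinear functional below \<open>p\<close>, and minimality makes it linear.
\<close>

lemma linear_below_sublinear:
  assumes p: "sublinear p"
  obtains l where "linear l" "l \<le> p"
proof -
  let ?A = "{q. sublinear q \<and> q \<le> p}"
  have po: "partial_order_on ?A (relation_of (\<lambda>q q'. q' \<le> q) ?A)"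
    by (rule partial_order_on_relation_ofI) auto
  have "\<exists>u\<in>?A. \<forall>q\<in>C. u \<le> q" if "C \<in> Chains (relation_of (\<lambda>q q'. q' \<le> q) ?A)" for C
  proof (cases "C = {}")
    case True
    then show ?thesis using p by auto
  next
    case False
    have sub: "\<And>q. q \<in> C \<Longrightarrow> sublinear q \<and> q \<le> p"
      and chain: "\<And>q q'. q \<in> C \<Longrightarrow> q' \<in> C \<Longrightarrow> q \<le> q' \<or> q' \<le> q"
      using that by (auto simp: Chains_def relation_of_def)
    let ?u = "\<lambda>x. INF q\<in>C. q x"
    have u: "sublinear ?u" "\<And>q. q \<in> C \<Longrightarrow> ?u \<le> q"
      using sublinear_INF_chain[OF False sub chain] by (auto intro!: le_funI)
    obtain q where "q \<in> C" using False by auto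
    then have "?u \<le> p" using u(2)[of q] sub[of q] by auto
    then show ?thesis using u by blast
  qed
  then obtain l where l: "l \<in> ?A" "\<And>q. q \<in> ?A \<Longrightarrow> q \<le> l \<Longrightarrow> q = l"
    using predicate_Zorn[OF po] by blast
  have "linear l"
    using l by (intro minimal_sublinear_imp_linear) (auto intro: order_trans)
  then show thesis using that l(1) by blast
qed

text \<open>
  Lowering \<open>p\<close> along \<open>x\<close> first pins the value of the linear functional at \<open>x\<close> from below.
\<close>

theorem Hahn_Banach_attained:
  assumes p: "sublinear p"
  obtains l where "linear l" "\<And>y. l y \<le> p y" "l x = p x"
proof -
  let ?q = "\<lambda>u. INF t\<in>{0..}. p (u + t *\<^sub>R x) - t * p x"
  obtain l where l: "linear l" "l \<le> ?q"
    using linear_below_sublinear[OF sublinear_lowered_along(1)[OF p]] by blast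
  have le: "l y \<le> p y" for y
    using le_funD[OF l(2), of y] sublinear_lowered_along(2)[OF p, where x = y and y = x] by simp
  have "l (- x) \<le> - p x"
    using le_funD[OF l(2), of "- x"] sublinear_lowered_along(3)[OF p, where y = x] by simp
  then have "l x = p x" using le[of x] linear_neg[OF l(1), of x] by simp
  then show thesis using that l(1) le by blast
qed

section \<open>Positive functionals on bounded measurable functions\<close>

lemma sum_fun_apply: "(\<Sum>i\<in>I. f i) x = (\<Sum>i\<in>I. f i x)" for f :: "'i \<Rightarrow> 'a \<Rightarrow> 'b::comm_monoid_add"
  by (induction I rule: infinite_finite_induct) auto

text \<open>
  The bound is required on the whole type and not only on \<open>space M\<close>. This loses nothing, since
  truncation gives every class in \<^const>\<open>Linf_c\<close> such a representative.
\<close>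

definition bounded_measurable :: "'a measure \<Rightarrow> ('a \<Rightarrow> real) set" where
  "bounded_measurable M = {x \<in> borel_measurable M. \<exists>c. \<forall>\<omega>. \<bar>x \<omega>\<bar> \<le> c}"

lemma bounded_measurableI:
  "x \<in> borel_measurable M \<Longrightarrow> (\<And>\<omega>. \<bar>x \<omega>\<bar> \<le> c) \<Longrightarrow> x \<in> bounded_measurable M"
  by (auto simp: bounded_measurable_def)

lemma subspace_bounded_measurable: "subspace (bounded_measurable M)"
proof (rule subspaceI)
  show "0 \<in> bounded_measurable M"
    by (rule bounded_measurableI[where c = 0]) (auto simp: zero_fun_def)
next
  fix x y assume "x \<in> bounded_measurable M" "y \<in> bounded_measurable M"
  then obtain c d where *: "x \<in> borel_measurable M" "y \<in> borel_measurable M"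
    and c: "\<And>\<omega>. \<bar>x \<omega>\<bar> \<le> c" and d: "\<And>\<omega>. \<bar>y \<omega>\<bar> \<le> d"
    by (auto simp: bounded_measurable_def)
  have "\<bar>(x + y) \<omega>\<bar> \<le> c + d" for \<omega>
    using c[of \<omega>] d[of \<omega>] by simp
  then show "x + y \<in> bounded_measurable M"
    using * by (intro bounded_measurableI) (auto simp: plus_fun_def)
next
  fix t x assume "x \<in> bounded_measurable M"
  then obtain c where *: "x \<in> borel_measurable M" and c: "\<And>\<omega>. \<bar>x \<omega>\<bar> \<le> c"
    by (auto simp: bounded_measurable_def)
  have "\<bar>(t *\<^sub>R x) \<omega>\<bar> \<le> \<bar>t\<bar> * c" for \<omega>
    using c[of \<omega>] by (auto simp: abs_mult intro: mult_left_mono)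
  then show "t *\<^sub>R x \<in> bounded_measurable M"
    using * by (intro bounded_measurableI) (auto simp: scaleR_fun_def)
qed

lemma indicator_bounded_measurable:
  "A \<in> sets M \<Longrightarrow> indicator A \<in> bounded_measurable M"
  by (rule bounded_measurableI[where c = 1]) (auto simp: indicator_def)

text \<open>
  Rounding down to multiples of \<open>1 / n\<close> approximates a bounded function uniformly by a finite
  combination of indicators, on which a linear functional is determined by its values on
  indicators.
\<close>

lemma floor_discretization:
  fixes n :: nat
  assumes x: "x \<in> bounded_measurable M" and n: "n > 0"
  obtains I :: "int set" and A where "finite I" "\<And>k. A k \<in> sets M"
    "\<And>\<omega>. \<omega> \<in> space M \<Longrightarrow> 0 \<le> x \<omega> - (\<Sum>k\<in>I. (real_of_int k / n) *\<^sub>R indicator (A k)) \<omega>"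
    "\<And>\<omega>. \<omega> \<in> space M \<Longrightarrow> x \<omega> - (\<Sum>k\<in>I. (real_of_int k / n) *\<^sub>R indicator (A k)) \<omega> \<le> 1 / n"
proof -
  obtain c where [measurable]: "x \<in> borel_measurable M" and c: "\<And>\<omega>. \<bar>x \<omega>\<bar> \<le> c"
    using x by (auto simp: bounded_measurable_def)
  let ?A = "\<lambda>k::int. {\<omega> \<in> space M. \<lfloor>n * x \<omega>\<rfloor> = k}" and ?I = "{\<lfloor>- (n * c)\<rfloor>..\<lfloor>n * c\<rfloor>}"
  let ?y = "\<Sum>k\<in>?I. (real_of_int k / n) *\<^sub>R indicator (?A k)"
  have y: "?y \<omega> = \<lfloor>n * x \<omega>\<rfloor> / n" if "\<omega> \<in> space M" for \<omega>
  proof -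
    have "- (n * c) \<le> n * x \<omega>" "n * x \<omega> \<le> n * c"
      using mult_left_mono[of "- c" "x \<omega>" n] mult_left_mono[of "x \<omega>" c n] c[of \<omega>]
      by (simp_all add: abs_le_iff)
    then have mem: "\<lfloor>n * x \<omega>\<rfloor> \<in> ?I" by (auto intro: floor_mono)
    have "?y \<omega> = (\<Sum>k\<in>?I. if k = \<lfloor>n * x \<omega>\<rfloor> then real_of_int k / n else 0)"
      unfolding sum_fun_apply using that by (intro sum.cong) (auto simp: indicator_def)
    then show ?thesis using mem by simp
  qed
  show thesis
  proof (rule that[of ?I ?A])
    fix \<omega> assume \<omega>: "\<omega> \<in> space M"
    have "of_int \<lfloor>n * x \<omega>\<rfloor> \<le> n * x \<omega>" "n * x \<omega> < of_int \<lfloor>n * x \<omega>\<rfloor> + 1"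
      by (rule of_int_floor_le, rule real_of_int_floor_add_one_gt)
    then have "0 / real n \<le> (n * x \<omega> - of_int \<lfloor>n * x \<omega>\<rfloor>) / n"
      and "(n * x \<omega> - of_int \<lfloor>n * x \<omega>\<rfloor>) / n \<le> 1 / n"
      by (intro divide_right_mono; linarith)+
    then show "0 \<le> x \<omega> - ?y \<omega>" "x \<omega> - ?y \<omega> \<le> 1 / n"
      unfolding y[OF \<omega>] using n by (simp_all add: diff_divide_distrib)
  qed auto
qed

text \<open>
  The set function \<open>A \<mapsto> l(1\<^sub>A)\<close> is finitely additive by linearity, and continuity at the empty set
  makes it countably additive. Both \<open>l\<close> and the resulting integral are monotone and agree on
  combinations of indicators, so by uniform approximation they agree on all bounded measurable
  functions.
\<close>

theorem Daniell_bounded_measurable: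
  fixes l :: "('a \<Rightarrow> real) \<Rightarrow> real"
  assumes lin: "linear l"
    and nonneg: "\<And>x. x \<in> bounded_measurable M \<Longrightarrow> (\<And>\<omega>. \<omega> \<in> space M \<Longrightarrow> 0 \<le> x \<omega>) \<Longrightarrow> 0 \<le> l x"
    and cont: "\<And>A :: nat \<Rightarrow> 'a set. range A \<subseteq> sets M \<Longrightarrow> decseq A \<Longrightarrow> (\<Inter>n. A n) = {} \<Longrightarrow>
           (\<lambda>n. l (indicator (A n))) \<longlonglongrightarrow> 0"
  obtains N where "sets N = sets M" "finite_measure N"
    "\<And>A. A \<in> sets M \<Longrightarrow> measure N A = l (indicator A)"
    "\<And>x. x \<in> bounded_measurable M \<Longrightarrow> integral\<^sup>L N x = l x"
proof -
  note sub = subspace_bounded_measurable[of M]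
  have mono: "l x \<le> l y"
    if "x \<in> bounded_measurable M" "y \<in> bounded_measurable M" "\<And>\<omega>. \<omega> \<in> space M \<Longrightarrow> x \<omega> \<le> y \<omega>" for x y
  proof -
    have "0 \<le> l (y - x)" using that by (intro nonneg subspace_diff[OF sub]) auto
    then show ?thesis by (simp add: linear_diff[OF lin])
  qed
  have ind0: "0 \<le> l (indicator A)" if "A \<in> sets M" for A
    using that by (intro nonneg indicator_bounded_measurable) auto
  define N where "N = measure_of (space M) (sets M) (\<lambda>A. ennreal (l (indicator A)))"
  have sets: "sets N = sets M" by (simp add: N_def)
  have emeasure: "emeasure N A = ennreal (l (indicator A))" if "A \<in> sets M" for A
    unfolding N_def
  proof (rule emeasure_measure_of_sigma)
    show "sigma_algebra (space M) (sets M)" by (rule sets.sigma_algebra_axioms)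
    have "(indicator {} :: 'a \<Rightarrow> real) = 0" by (auto simp: fun_eq_iff)
    then show pos: "positive (sets M) (\<lambda>A. ennreal (l (indicator A)))"
      by (simp add: positive_def linear_0[OF lin])
    show "countably_additive (sets M) (\<lambda>A. ennreal (l (indicator A)))"
    proof (rule sets.empty_continuous_imp_countably_additive[OF pos])
      show "additive (sets M) (\<lambda>A. ennreal (l (indicator A)))"
        unfolding additive_def
      proof (intro ballI impI)
        fix A B assume AB: "A \<in> sets M" "B \<in> sets M" "A \<inter> B = {}"
        then have "(indicator (A \<union> B) :: 'a \<Rightarrow> real) = indicator A + indicator B"
          by (auto simp: fun_eq_iff indicator_def)
        then show "ennreal (l (indicator (A \<union> B))) = ennreal (l (indicator A)) + ennreal (l (indicator B))"
          using AB by (simp add: linear_add[OF lin] ind0)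
      qed
    next
      fix A :: "nat \<Rightarrow> 'a set" assume "range A \<subseteq> sets M" "decseq A" "(\<Inter>i. A i) = {}"
      then show "(\<lambda>i. ennreal (l (indicator (A i)))) \<longlonglongrightarrow> 0"
        using tendsto_ennrealI[OF cont[of A]] by simp
    qed simp
  qed (use that in auto)
  have measure: "measure N A = l (indicator A)" if "A \<in> sets M" for A
    using emeasure[OF that] ind0[OF that] by (simp add: Sigma_Algebra.measure_def)
  have space: "space N = space M" by (simp add: N_def)
  interpret N: finite_measure N
    by standard (simp add: space emeasure)
  have int: "integrable N x" if "x \<in> bounded_measurable M" for x
  proof -
    obtain c where "x \<in> borel_measurable N" "\<And>\<omega>. \<bar>x \<omega>\<bar> \<le> c"
      using \<open>x \<in> bounded_measurable M\<close> sets by (auto simp: bounded_measurable_def cong: measurable_cong_sets)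
    then show ?thesis by (intro N.integrable_const_bound[where B = c]) auto
  qed
  have "integral\<^sup>L N x = l x" if x: "x \<in> bounded_measurable M" for x
  proof -
    let ?m = "l (indicator (space M))"
    \<comment> \<open>Both values lie between the common value at the approximation from below and that value
      plus \<open>?m / n\<close>.\<close>
    have "\<bar>integral\<^sup>L N x - l x\<bar> \<le> ?m / n" if n: "n > 0" for n :: nat
    proof -
      obtain I :: "int set" and A where I: "finite I" and A: "\<And>k. A k \<in> sets M"
        and xy: "\<And>\<omega>. \<omega> \<in> space M \<Longrightarrow> 0 \<le> x \<omega> - (\<Sum>k\<in>I. (real_of_int k / n) *\<^sub>R indicator (A k)) \<omega>"
        "\<And>\<omega>. \<omega> \<in> space M \<Longrightarrow> x \<omega> - (\<Sum>k\<in>I. (real_of_int k / n) *\<^sub>R indicator (A k)) \<omega> \<le> 1 / n"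
        using floor_discretization[OF x n] by blast
      define y :: "'a \<Rightarrow> real" where "y = (\<Sum>k\<in>I. (real_of_int k / n) *\<^sub>R indicator (A k))"
      let ?z = "y + (1 / n) *\<^sub>R indicator (space M)"
      have ind: "indicator (space M) \<in> bounded_measurable M"
        by (rule indicator_bounded_measurable) simp
      have y: "y \<in> bounded_measurable M"
        unfolding y_def using A
        by (intro subspace_sum[OF sub] subspace_scale[OF sub] indicator_bounded_measurable)
      have z: "?z \<in> bounded_measurable M"
        by (intro subspace_add[OF sub] subspace_scale[OF sub] y ind)
      have "l y = (\<Sum>k\<in>I. real_of_int k / n * measure N (A k))"
        unfolding y_def by (simp add: linear_sum[OF lin] linear_scale[OF lin] measure A)
      also have "\<dots> = integral\<^sup>L N (\<lambda>\<omega>. \<Sum>k\<in>I. real_of_int k / n * indicator (A k) \<omega>)"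
        using A sets sets.sets_into_space[of _ M]
        by (subst Bochner_Integration.integral_sum)
          (auto simp: space Int_absorb2 N.emeasure_finite less_top[symmetric])
      finally have ly: "l y = integral\<^sup>L N y" by (simp add: y_def sum_fun_apply[abs_def] fun_eq_iff)
      have "l y \<le> l x" "l x \<le> l ?z" "integral\<^sup>L N y \<le> integral\<^sup>L N x" "integral\<^sup>L N x \<le> integral\<^sup>L N ?z"
        using xy[folded y_def]
        by (auto intro!: mono integral_mono int x y z simp: space diff_le_eq add.commute[of _ "y _"])
      moreover have "l ?z = l y + ?m / n"
        by (simp add: linear_add[OF lin] linear_scale[OF lin])
      moreover have "integral\<^sup>L N ?z = integral\<^sup>L N y + ?m / n"
        using int[OF y] int[OF ind] sets
        by (simp add: plus_fun_def measure space)
      ultimately show ?thesis using ly by linarith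
    qed
    then have "(\<lambda>n. ?m / real (Suc n)) \<longlonglongrightarrow> 0 \<Longrightarrow> \<bar>integral\<^sup>L N x - l x\<bar> \<le> 0"
      by (intro LIMSEQ_le_const) (auto simp del: of_nat_Suc)
    moreover have "(\<lambda>n. ?m / real (Suc n)) \<longlonglongrightarrow> 0"
      by (rule LIMSEQ_Suc[OF lim_const_over_n])
    ultimately show ?thesis by simp
  qed
  then show thesis
    using that[OF sets N.finite_measure_axioms] measure by blast
qed

section \<open>Finite measures as signed measures\<close>

text \<open>
  For a nonnegative set function that is monotone, the supremum over the measurable subsets of \<open>A\<close>
  is attained at \<open>A\<close>, so the Jordan decomposition of a finite measure is trivial.
\<close>

lemma pos_measure_measure:
  assumes "finite_measure N" and sets: "sets N = sets M"
  shows "pos_measure M (measure N) = N"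
proof -
  interpret N: finite_measure N by fact
  have "upper_var M (measure N) A = emeasure N A" if A: "A \<in> sets M" for A
    unfolding upper_var_def using A sets
    by (intro SUP_eqI) (auto simp: N.emeasure_eq_measure intro!: N.finite_measure_mono ennreal_leI)
  then have "pos_measure M (measure N) = measure_of (space M) (sets M) (emeasure N)"
    unfolding pos_measure_def
    by (intro measure_of_eq) (auto simp: sets.space_closed sets.sigma_sets_eq)
  then show ?thesis
    using measure_of_of_measure[of N] sets sets_eq_imp_space_eq[OF sets] by simp
qed

lemma neg_measure_measure:
  assumes "finite_measure N"
  shows "neg_measure M (measure N) = null_measure M"
proof -
  have "upper_var M (\<lambda>A. - measure N A) A = 0" for A
    unfolding upper_var_def by (intro SUP_eqI) (auto simp: ennreal_neg)
  then have "neg_measure M (measure N) = measure_of (space M) (sets M) (\<lambda>_. 0)"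
    unfolding neg_measure_def pos_measure_def
    by (intro measure_of_eq) (auto simp: sets.space_closed)
  also have "\<dots> = null_measure M"
    by (simp add: null_measure_def)
  finally show ?thesis .
qed

lemma abs_measure_measure:
  assumes "finite_measure N" and sets: "sets N = sets M"
  shows "abs_measure M (measure N) = N"
  using measure_of_of_measure[of N] sets sets_eq_imp_space_eq[OF sets]
  by (simp add: abs_measure_def pos_measure_measure neg_measure_measure assms)

lemma measure_in_ca:
  assumes "finite_measure N" and sets: "sets N = sets M" and "absolutely_continuous Q N"
  shows "measure N \<in> ca M Q"
proof -
  interpret N: finite_measure N by fact
  have "signed_measure M (measure N)"
    unfolding signed_measure_def using N.finite_measure_UNION by (auto simp: sets)
  then show ?thesis using assms by (simp add: ca_def abs_measure_measure)
qed

section \<open>The two extensions of a coherent risk measure\<close>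

text \<open>
  The Fenchel inequality: \<open>X\<close> is one of the competitors in the supremum that defines the conjugate.
\<close>

lemma rho_D_le_rho_E:
  assumes X: "X \<in> Linf_c M \<P>"
  shows "rho_D M \<P> \<rho> Q X \<le> rho_E M \<P> \<rho> Q X"
  unfolding rho_D_def
proof (rule SUP_least)
  fix \<mu> assume "\<mu> \<in> ca M Q"
  have "ereal (class_integral M \<mu> X) - rho_E M \<P> \<rho> Q X \<le> rho_conj M \<P> \<rho> Q \<mu>"
    unfolding rho_conj_def by (rule SUP_upper[OF X])
  then show "ereal (class_integral M \<mu> X) - rho_conj M \<P> \<rho> Q \<mu> \<le> rho_E M \<P> \<rho> Q X"
    by (cases "rho_conj M \<P> \<rho> Q \<mu>"; cases "rho_E M \<P> \<rho> Q X") auto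
qed

text \<open>
  The kernel of the map that sends a bounded measurable function to its class modulo \<open>Q\<close>-almost
  sure equality.
\<close>

definition as_null :: "'a measure \<Rightarrow> 'a measure \<Rightarrow> ('a \<Rightarrow> real) set" where
  "as_null M Q = {k \<in> bounded_measurable M. AE \<omega> in Q. k \<omega> = 0}"

lemma subspace_as_null: "subspace (as_null M Q)"
proof (rule subspaceI)
  show "0 \<in> as_null M Q"
    using subspace_0[OF subspace_bounded_measurable] by (auto simp: as_null_def)
next
  fix x y assume "x \<in> as_null M Q" "y \<in> as_null M Q"
  then show "x + y \<in> as_null M Q"
    by (auto simp: as_null_def intro: subspace_add[OF subspace_bounded_measurable] elim: AE_mp)
next
  fix t x assume "x \<in> as_null M Q"
  then show "t *\<^sub>R x \<in> as_null M Q"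
    by (auto simp: as_null_def intro: subspace_scale[OF subspace_bounded_measurable])
qed

locale coherent_risk =
  fixes M :: "'a measure" and \<P> :: "'a measure set" and \<rho> :: "('a \<Rightarrow> real) set \<Rightarrow> real"
  assumes prob: "\<P> \<subseteq> space (prob_algebra M)"
    and coherent: "coherent_risk_measure M \<P> \<rho>"
begin

lemma quasi_surely_everywhere: "(\<And>\<omega>. \<omega> \<in> space M \<Longrightarrow> \<phi> \<omega>) \<Longrightarrow> quasi_surely M \<P> \<phi>"
  by (auto simp: quasi_surely_def polar_sets_def upper_prob_def intro!: bexI[of _ "{}"] simp flip: bot_ennreal)

lemma qs_class_refl: "x \<in> borel_measurable M \<Longrightarrow> x \<in> qs_class M \<P> x"
  by (auto simp: qs_class_def qs_rel_def intro: quasi_surely_everywhere)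

lemma qs_class_in_Linf_c:
  assumes "x \<in> bounded_measurable M"
  shows "qs_class M \<P> x \<in> Linf_c M \<P>"
proof -
  obtain c where x: "x \<in> borel_measurable M" and c: "\<And>\<omega>. \<bar>x \<omega>\<bar> \<le> c"
    using assms by (auto simp: bounded_measurable_def)
  let ?c = "max c 1"
  have "le_c M \<P> (qs_class M \<P> (\<lambda>\<omega>. \<bar>x \<omega>\<bar>)) (qs_class M \<P> (\<lambda>_. ?c))"
    unfolding le_c_def
  proof (intro bexI)
    show "quasi_surely M \<P> (\<lambda>\<omega>. \<bar>x \<omega>\<bar> \<le> ?c)"
      using c by (intro quasi_surely_everywhere) (simp add: max.coboundedI1)
  qed (use x in \<open>auto intro!: qs_class_refl\<close>)
  moreover have "qs_class M \<P> x \<in> L0_c M \<P>"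
    using x by (auto simp: L0_c_def qs_class_def intro: quotientI)
  ultimately show ?thesis
    unfolding Linf_c_def using qs_class_refl[OF x] by (auto intro!: exI[of _ ?c] bexI[of _ x])
qed

text \<open>
  A class in \<^const>\<open>Linf_c\<close> is bounded only outside a polar event. Truncating a member at its bound
  changes it only on such an event.
\<close>

lemma Linf_c_representative:
  assumes "X \<in> Linf_c M \<P>"
  obtains x where "x \<in> bounded_measurable M" "X = qs_class M \<P> x"
proof -
  obtain c x where X: "X \<in> L0_c M \<P>" "x \<in> X"
    and le: "le_c M \<P> (qs_class M \<P> (\<lambda>\<omega>. \<bar>x \<omega>\<bar>)) (qs_class M \<P> (\<lambda>_. c))"
    using assms by (auto simp: Linf_c_def)
  note eq = equiv_qs_rel[OF prob]
  obtain z where z: "X = qs_rel M \<P> `` {z}" using X by (auto simp: L0_c_def elim: quotientE)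
  then have zx: "(z, x) \<in> qs_rel M \<P>" using X by auto
  then have [measurable]: "x \<in> borel_measurable M" by (auto simp: qs_rel_def)
  obtain u v where u: "quasi_surely M \<P> (\<lambda>\<omega>. \<bar>x \<omega>\<bar> = u \<omega>)"
    and v: "quasi_surely M \<P> (\<lambda>\<omega>. c = v \<omega>)" and uv: "quasi_surely M \<P> (\<lambda>\<omega>. u \<omega> \<le> v \<omega>)"
    using le by (auto simp: le_c_def qs_class_def qs_rel_def)
  let ?y = "\<lambda>\<omega>. max (- \<bar>c\<bar>) (min (x \<omega>) \<bar>c\<bar>)"
  have "quasi_surely M \<P> (\<lambda>\<omega>. (\<bar>x \<omega>\<bar> = u \<omega> \<and> c = v \<omega>) \<and> u \<omega> \<le> v \<omega>)"
    by (intro quasi_surely_conj[OF prob] u v uv)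
  then have "quasi_surely M \<P> (\<lambda>\<omega>. x \<omega> = ?y \<omega>)"
    by (rule quasi_surely_mono) auto
  then have "(x, ?y) \<in> qs_rel M \<P>" by (simp add: qs_rel_def)
  then have "X = qs_class M \<P> ?y"
    unfolding qs_class_def z using equiv_class_eq[OF eq] zx by metis
  moreover have "?y \<in> bounded_measurable M"
    by (rule bounded_measurableI[where c = "\<bar>c\<bar>"]) auto
  ultimately show thesis by (rule that[rotated])
qed

abbreviation (input) risk :: "('a \<Rightarrow> real) \<Rightarrow> real" where
  "risk x \<equiv> \<rho> (qs_class M \<P> x)"

lemma bounded_measurable_refl: "x \<in> bounded_measurable M \<Longrightarrow> x \<in> qs_class M \<P> x"
  by (auto simp: bounded_measurable_def intro: qs_class_refl)

lemma risk_mono: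
  assumes "x \<in> bounded_measurable M" "y \<in> bounded_measurable M"
    and "\<And>\<omega>. \<omega> \<in> space M \<Longrightarrow> x \<omega> \<le> y \<omega>"
  shows "risk x \<le> risk y"
proof -
  have "le_c M \<P> (qs_class M \<P> x) (qs_class M \<P> y)"
    unfolding le_c_def
    by (intro bexI[of _ x] bexI[of _ y] quasi_surely_everywhere assms bounded_measurable_refl)
  then show ?thesis
    using coherent assms by (auto simp: coherent_risk_measure_def qs_class_in_Linf_c)
qed

lemma risk_scale:
  assumes "t \<ge> 0" and x: "x \<in> bounded_measurable M"
  shows "risk (t *\<^sub>R x) = t * risk x"
proof -
  have "t *\<^sub>R x = (\<lambda>\<omega>. t * x \<omega>)" by (simp add: scaleR_fun_def)
  then show ?thesis
    using coherent qs_class_in_Linf_c[OF x] bounded_measurable_refl[OF x] assms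
    unfolding coherent_risk_measure_def by auto
qed

text \<open>
  Convexity at the midpoint, rescaled by positive homogeneity.
\<close>

lemma risk_add:
  assumes x: "x \<in> bounded_measurable M" and y: "y \<in> bounded_measurable M"
  shows "risk (x + y) \<le> risk x + risk y"
proof -
  note sub = subspace_bounded_measurable[of M]
  let ?h = "(1/2) *\<^sub>R (x + y)"
  have h: "?h = (\<lambda>\<omega>. (1/2) * x \<omega> + (1 - 1/2) * y \<omega>)" by (simp add: fun_eq_iff algebra_simps)
  have "\<forall>X\<in>Linf_c M \<P>. \<forall>Y\<in>Linf_c M \<P>. \<forall>x\<in>X. \<forall>y\<in>Y. \<forall>t\<in>{0..1}.
      risk (\<lambda>\<omega>. t * x \<omega> + (1 - t) * y \<omega>) \<le> t * \<rho> X + (1 - t) * \<rho> Y"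
    using coherent by (simp add: coherent_risk_measure_def)
  from this[rule_format, OF qs_class_in_Linf_c[OF x] qs_class_in_Linf_c[OF y]
      bounded_measurable_refl[OF x] bounded_measurable_refl[OF y], of "1/2"]
  have "risk ?h \<le> (1/2) * risk x + (1 - 1/2) * risk y"
    unfolding h by simp
  moreover have "risk ?h = (1/2) * risk (x + y)"
    by (intro risk_scale subspace_add[OF sub] x y) simp
  ultimately show ?thesis by simp
qed

context
  fixes Q assumes Q: "Q \<in> prob_c M \<P>"
begin

lemma sets_Q: "sets Q = sets M"
  using Q by (auto simp: prob_c_def space_prob_algebra)

lemma AE_of_qs_class:
  assumes "y \<in> qs_class M \<P> x"
  shows "AE \<omega> in Q. x \<omega> = y \<omega>"
proof -
  obtain N where N: "N \<in> polar_sets M \<P>" "\<forall>\<omega>\<in>space M - N. x \<omega> = y \<omega>"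
    using assms by (auto simp: qs_class_def qs_rel_def quasi_surely_def)
  then have "N \<in> null_sets Q"
    using Q sets_Q by (auto simp: prob_c_def polar_sets_def null_sets_def)
  then show ?thesis using N(2) sets_eq_imp_space_eq[OF sets_Q] by (intro AE_I') auto
qed

lemma j_map_eq_iff:
  assumes "x \<in> bounded_measurable M" "y \<in> bounded_measurable M"
  shows "j_map Q (qs_class M \<P> x) = j_map Q (qs_class M \<P> y) \<longleftrightarrow> y - x \<in> as_null M Q"
proof -
  have xy: "x \<in> borel_measurable M" "y \<in> borel_measurable M" "x \<in> borel_measurable Q" "y \<in> borel_measurable Q"
    using assms sets_Q by (auto simp: bounded_measurable_def cong: measurable_cong_sets)
  have "j_map Q (qs_class M \<P> x) = j_map Q (qs_class M \<P> y) \<longleftrightarrow> as_class Q x = as_class Q y"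
    using j_map_qs_class[OF prob Q] xy by simp
  also have "\<dots> \<longleftrightarrow> (AE \<omega> in Q. x \<omega> = y \<omega>)"
  proof
    assume "as_class Q x = as_class Q y"
    moreover have "y \<in> as_class Q y" using xy by (simp add: as_class_def as_rel_def)
    ultimately have "y \<in> as_class Q x" by simp
    then show "AE \<omega> in Q. x \<omega> = y \<omega>" by (simp add: as_class_def as_rel_def)
  next
    assume eq: "AE \<omega> in Q. x \<omega> = y \<omega>"
    have "(AE \<omega> in Q. x \<omega> = z \<omega>) \<longleftrightarrow> (AE \<omega> in Q. y \<omega> = z \<omega>)" for z
      by (rule eventually_subst, rule eventually_mono[OF eq]) simp
    then show "as_class Q x = as_class Q y" using xy by (simp add: as_class_def as_rel_def Image_def)
  qed
  also have "\<dots> \<longleftrightarrow> y - x \<in> as_null M Q"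
    using subspace_diff[OF subspace_bounded_measurable, of y M x] assms
    by (simp add: as_null_def eq_commute[of "x _"])
  finally show ?thesis .
qed

lemma rho_E_eq_INF:
  assumes x: "x \<in> bounded_measurable M"
  shows "rho_E M \<P> \<rho> Q (qs_class M \<P> x) = (INF k\<in>as_null M Q. ereal (risk (x + k)))"
proof (rule antisym)
  show "rho_E M \<P> \<rho> Q (qs_class M \<P> x) \<le> (INF k\<in>as_null M Q. ereal (risk (x + k)))"
  proof (rule INF_greatest)
    fix k assume k: "k \<in> as_null M Q"
    then have xk: "x + k \<in> bounded_measurable M"
      using x by (auto simp: as_null_def intro: subspace_add[OF subspace_bounded_measurable])
    then have "j_map Q (qs_class M \<P> x) = j_map Q (qs_class M \<P> (x + k))"
      using k x by (subst j_map_eq_iff) auto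
    then show "rho_E M \<P> \<rho> Q (qs_class M \<P> x) \<le> ereal (risk (x + k))"
      unfolding rho_E_def using qs_class_in_Linf_c[OF xk] by (intro Inf_lower) blast
  qed
  show "(INF k\<in>as_null M Q. ereal (risk (x + k))) \<le> rho_E M \<P> \<rho> Q (qs_class M \<P> x)"
    unfolding rho_E_def
  proof (rule Inf_greatest, safe)
    fix r Y assume j: "j_map Q (qs_class M \<P> x) = j_map Q Y" and Y: "Y \<in> Linf_c M \<P>" "\<rho> Y \<le> r"
    obtain y where y: "y \<in> bounded_measurable M" "Y = qs_class M \<P> y"
      using Linf_c_representative[OF Y(1)] .
    have "y - x \<in> as_null M Q" using j_map_eq_iff[OF x y(1)] j y(2) by simp
    then have "(INF k\<in>as_null M Q. ereal (risk (x + k))) \<le> ereal (risk (x + (y - x)))"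
      by (rule INF_lower)
    also have "\<dots> \<le> ereal r" using Y y by simp
    finally show "(INF k\<in>as_null M Q. ereal (risk (x + k))) \<le> ereal r" .
  qed
qed

text \<open>
  The integral of a class is taken at an arbitrary representative. Absolute continuity makes the
  choice immaterial, as members of a class agree \<open>Q\<close>-almost surely.
\<close>

lemma class_integral_measure:
  assumes N: "finite_measure N" "sets N = sets M" "absolutely_continuous Q N"
    and x: "x \<in> bounded_measurable M"
  shows "class_integral M (measure N) (qs_class M \<P> x) = integral\<^sup>L N x"
proof -
  define y where "y = (SOME y. y \<in> qs_class M \<P> x)"
  have y: "y \<in> qs_class M \<P> x"
    unfolding y_def by (rule someI[where P = "\<lambda>y. y \<in> qs_class M \<P> x", OF bounded_measurable_refl[OF x]])
  have "AE \<omega> in N. x \<omega> = y \<omega>"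
    using absolutely_continuous_AE[OF _ N(3) AE_of_qs_class[OF y]] N(2) sets_Q by simp
  moreover have "x \<in> borel_measurable N" "y \<in> borel_measurable N"
    using x y N(2) by (auto simp: bounded_measurable_def qs_class_def qs_rel_def cong: measurable_cong_sets)
  ultimately have "integral\<^sup>L N x = integral\<^sup>L N y" by (intro integral_cong_AE)
  then show ?thesis
    by (simp add: class_integral_def Let_def N neg_measure_measure pos_measure_measure
        integral_null_measure flip: y_def)
qed

text \<open>
  Moving along \<open>k\<close> does not change the class modulo \<open>Q\<close>, but lowers the risk without bound.
\<close>

lemma rho_E_minus_infinity:
  assumes k: "k \<in> as_null M Q" "risk k < 0" and x: "x \<in> bounded_measurable M"
  shows "rho_E M \<P> \<rho> Q (qs_class M \<P> x) = - \<infinity>"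
  unfolding rho_E_eq_INF[OF x]
proof (rule ereal_bot)
  fix c :: real
  have kb: "k \<in> bounded_measurable M" using k by (simp add: as_null_def)
  \<comment> \<open>The multiple of \<open>k\<close> that pushes \<open>risk x + t * risk k\<close> down to \<open>c\<close>.\<close>
  define t where "t = max 0 ((risk x - c) / - risk k)"
  have t: "t \<ge> 0" by (simp add: t_def)
  have "(risk x - c) / - risk k \<le> t" by (simp add: t_def)
  then have "risk x - c \<le> t * - risk k" using k(2) by (subst (asm) pos_divide_le_eq) simp
  then have "risk x + t * risk k \<le> c" by simp
  moreover have "risk (x + t *\<^sub>R k) \<le> risk x + t * risk k"
    using risk_add[OF x subspace_scale[OF subspace_bounded_measurable kb], of t] risk_scale[OF t kb]
    by simp
  ultimately have "ereal (risk (x + t *\<^sub>R k)) \<le> ereal c" by simp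
  moreover have "t *\<^sub>R k \<in> as_null M Q" by (rule subspace_scale[OF subspace_as_null k(1)])
  ultimately show "(INF k\<in>as_null M Q. ereal (risk (x + k))) \<le> ereal c"
    by (rule INF_lower2[rotated])
qed

text \<open>
  The Hahn-Banach functional for \<open>\<rho>\<^sub>E\<close> at \<open>x\<close>, realized as a measure. It lies below
  \<open>y \<mapsto> r(y + k)\<close> for every \<open>k \<in> K\<close>: the choice \<open>k = 0\<close> gives positivity and continuity along
  decreasing events, and the choice \<open>k = - y\<close> for \<open>y = 1\<^sub>A\<close> with \<open>Q(A) = 0\<close> gives absolute
  continuity.
\<close>

lemma rho_E_attained:
  assumes cont: "\<And>A :: nat \<Rightarrow> 'a set. range A \<subseteq> sets M \<Longrightarrow> decseq A \<Longrightarrow> (\<Inter>n. A n) = {} \<Longrightarrow>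
           (\<lambda>n. risk (indicator (A n))) \<longlonglongrightarrow> 0"
    and nonneg: "\<And>k. k \<in> as_null M Q \<Longrightarrow> 0 \<le> risk k"
    and x: "x \<in> bounded_measurable M"
  obtains N where "finite_measure N" "sets N = sets M" "absolutely_continuous Q N"
    "\<And>y. y \<in> bounded_measurable M \<Longrightarrow>
      ereal (integral\<^sup>L N y) \<le> rho_E M \<P> \<rho> Q (qs_class M \<P> y)"
    "rho_E M \<P> \<rho> Q (qs_class M \<P> x) = ereal (integral\<^sup>L N x)"
proof -
  note B = subspace_bounded_measurable[of M] and K = subspace_as_null[of M Q]
  have KB: "k \<in> bounded_measurable M" if "k \<in> as_null M Q" for k
    using that by (simp add: as_null_def)
  obtain p where p: "sublinear p" and pr: "\<And>y. y \<in> bounded_measurable M \<Longrightarrow> p y = risk y"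
    by (rule sublinear_extension[OF B, where r = "\<lambda>x. risk x"]) (auto simp: risk_add risk_scale)
  let ?q = "\<lambda>y. INF k\<in>as_null M Q. p (y + k)"
  have p0: "0 \<le> p k" if "k \<in> as_null M Q" for k using nonneg[OF that] pr[OF KB[OF that]] by simp
  note q = sublinear_quotient[OF p K p0]
  have rho_q: "rho_E M \<P> \<rho> Q (qs_class M \<P> y) = ereal (?q y)" if y: "y \<in> bounded_measurable M" for y
  proof -
    have "rho_E M \<P> \<rho> Q (qs_class M \<P> y) = (INF k\<in>as_null M Q. ereal (p (y + k)))"
      unfolding rho_E_eq_INF[OF y]
      using pr subspace_add[OF B y] KB by (intro INF_cong) auto
    also have "\<dots> = ereal (?q y)"
      using ereal_Inf'[OF q(1)[of y]] subspace_0[OF K] by (fastforce simp: image_image)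
    finally show ?thesis .
  qed
  obtain l where l: "linear l" "\<And>y. l y \<le> ?q y" "l x = ?q x"
    using Hahn_Banach_attained[OF q(2), where x = x] by blast
  have l_le: "l y \<le> p (y + k)" if "k \<in> as_null M Q" for y k
    using l(2)[of y] cINF_lower[OF q(1)[of y] that] by simp
  have l_le_risk: "l y \<le> risk y" if "y \<in> bounded_measurable M" for y
    using l_le[OF subspace_0[OF K], of y] pr[OF that] by simp
  have l_nonneg: "0 \<le> l y"
    if y: "y \<in> bounded_measurable M" "\<And>\<omega>. \<omega> \<in> space M \<Longrightarrow> 0 \<le> y \<omega>" for y
  proof -
    have "l (- y) \<le> risk (- y)" by (rule l_le_risk[OF subspace_neg[OF B y(1)]])
    also have "\<dots> \<le> risk 0"
      using y by (intro risk_mono subspace_neg[OF B] subspace_0[OF B]) auto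
    also have "\<dots> = 0" using pr[OF subspace_0[OF B]] sublinear_zero[OF p] by simp
    finally show ?thesis using linear_neg[OF l(1)] by simp
  qed
  have l_cont: "(\<lambda>n. l (indicator (A n))) \<longlonglongrightarrow> 0"
    if A: "range A \<subseteq> sets M" "decseq A" "(\<Inter>n. A n) = {}" for A :: "nat \<Rightarrow> 'a set"
  proof (rule tendsto_sandwich[OF _ _ tendsto_const cont[OF A]])
    have ind: "indicator (A n) \<in> bounded_measurable M" for n
      using A(1) by (intro indicator_bounded_measurable) auto
    show "\<forall>\<^sub>F n in sequentially. 0 \<le> l (indicator (A n))"
      by (intro always_eventually allI l_nonneg ind) simp
    show "\<forall>\<^sub>F n in sequentially. l (indicator (A n)) \<le> risk (indicator (A n))"
      by (intro always_eventually allI l_le_risk ind)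
  qed
  obtain N where N: "sets N = sets M" "finite_measure N"
    "\<And>A. A \<in> sets M \<Longrightarrow> measure N A = l (indicator A)"
    "\<And>y. y \<in> bounded_measurable M \<Longrightarrow> integral\<^sup>L N y = l y"
    by (rule Daniell_bounded_measurable[OF l(1), of M]) (auto intro: l_nonneg l_cont)
  interpret N: finite_measure N by (rule N(2))
  have "absolutely_continuous Q N"
    unfolding absolutely_continuous_def
  proof
    fix A assume A: "A \<in> null_sets Q"
    then have AM: "A \<in> sets M" using sets_Q by auto
    have "AE \<omega> in Q. \<omega> \<notin> A" by (rule AE_not_in[OF A])
    then have "indicator A \<in> as_null M Q"
      using indicator_bounded_measurable[OF AM] by (auto simp: as_null_def elim: AE_mp)
    then have "l (indicator A) \<le> p (indicator A + (- indicator A))"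
      by (intro l_le subspace_neg[OF K])
    then have "measure N A \<le> 0" using sublinear_zero[OF p] N(3)[OF AM] by simp
    then show "A \<in> null_sets N"
      using AM N(1) measure_nonneg[of N A] by (intro null_setsI) (auto simp: N.emeasure_eq_measure)
  qed
  then show thesis
    using that[OF N(2,1)] rho_q x l(2,3) N(4) by auto
qed

text \<open>
  In the finite case the bound in \<open>rho_E_attained\<close> makes the conjugate at \<open>N\<close> nonpositive, so the
  term of \<open>N\<close> in the supremum is at least the integral of \<open>x\<close>, which equals \<open>\<rho>\<^sub>E(x)\<close>.
\<close>

lemma rho_E_le_rho_D:
  assumes cont: "\<And>A :: nat \<Rightarrow> 'a set. range A \<subseteq> sets M \<Longrightarrow> decseq A \<Longrightarrow> (\<Inter>n. A n) = {} \<Longrightarrow>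
           (\<lambda>n. risk (indicator (A n))) \<longlonglongrightarrow> 0"
    and X: "X \<in> Linf_c M \<P>"
  shows "rho_E M \<P> \<rho> Q X \<le> rho_D M \<P> \<rho> Q X"
proof -
  obtain x where x: "x \<in> bounded_measurable M" "X = qs_class M \<P> x"
    using Linf_c_representative[OF X] .
  show ?thesis
  proof (cases "\<exists>k\<in>as_null M Q. risk k < 0")
    case True
    then show ?thesis using rho_E_minus_infinity x by auto
  next
    case False
    then have nonneg: "0 \<le> risk k" if "k \<in> as_null M Q" for k using that by (auto simp: not_less)
    obtain N where N: "finite_measure N" "sets N = sets M" "absolutely_continuous Q N"
      and le: "\<And>y. y \<in> bounded_measurable M \<Longrightarrow>
        ereal (integral\<^sup>L N y) \<le> rho_E M \<P> \<rho> Q (qs_class M \<P> y)"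
      and eq: "rho_E M \<P> \<rho> Q (qs_class M \<P> x) = ereal (integral\<^sup>L N x)"
      using rho_E_attained[OF cont nonneg x(1)] by blast
    have "rho_conj M \<P> \<rho> Q (measure N) \<le> 0"
      unfolding rho_conj_def
    proof (rule SUP_least)
      fix Y assume "Y \<in> Linf_c M \<P>"
      then obtain y where y: "y \<in> bounded_measurable M" "Y = qs_class M \<P> y"
        by (rule Linf_c_representative)
      show "ereal (class_integral M (measure N) Y) - rho_E M \<P> \<rho> Q Y \<le> 0"
        using le[OF y(1)] class_integral_measure[OF N y(1)] y(2)
        by (cases "rho_E M \<P> \<rho> Q Y") auto
    qed
    then have "rho_E M \<P> \<rho> Q X \<le> ereal (class_integral M (measure N) X) - rho_conj M \<P> \<rho> Q (measure N)"
      unfolding x(2) eq class_integral_measure[OF N x(1)]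
      by (cases "rho_conj M \<P> \<rho> Q (measure N)") auto
    also have "\<dots> \<le> rho_D M \<P> \<rho> Q X"
      unfolding rho_D_def by (rule SUP_upper[OF measure_in_ca[OF N]])
    finally show ?thesis .
  qed
qed

end

end

theorem proposition4p17:
  fixes M :: "'a measure" and \<P> :: "'a measure set"
    and \<rho> :: "('a \<Rightarrow> real) set \<Rightarrow> real"
  assumes "\<P> \<noteq> {}" and "\<P> \<subseteq> space (prob_algebra M)"
    and "coherent_risk_measure M \<P> \<rho>"
    and "\<And>A :: nat \<Rightarrow> 'a set. range A \<subseteq> sets M \<Longrightarrow> decseq A \<Longrightarrow> (\<Inter>n. A n) = {} \<Longrightarrow>
           decseq (\<lambda>n. \<rho> (qs_class M \<P> (indicator (A n)))) \<and>
           (\<lambda>n. \<rho> (qs_class M \<P> (indicator (A n)))) \<longlonglongrightarrow> 0"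
  shows "\<forall>Q\<in>prob_c M \<P>. \<forall>X\<in>Linf_c M \<P>. rho_E M \<P> \<rho> Q X = rho_D M \<P> \<rho> Q X"
proof (intro ballI antisym)
  interpret coherent_risk M \<P> \<rho> by standard (fact assms)+
  fix Q X assume Q: "Q \<in> prob_c M \<P>" and X: "X \<in> Linf_c M \<P>"
  show "rho_E M \<P> \<rho> Q X \<le> rho_D M \<P> \<rho> Q X"
    using assms(4) by (intro rho_E_le_rho_D[OF Q _ X]) blast
  show "rho_D M \<P> \<rho> Q X \<le> rho_E M \<P> \<rho> Q X" by (rule rho_D_le_rho_E[OF X])
qed

end
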